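(* Consider any one of the three egg-drop problem variations (Standard Eggs, Replacement Eggs, Bonus Eggs), starting with $k\ge 1$ eggs and with an $N$-story building. For every algorithm $A$ solving this problem there is an algorithm $A'$ solving the same problem, under the same egg-supply rules, such that $A'$ is non-redundant and $A'$ never requires more experiments than $A$, i.e., on every instance the number of experiments performed by $A'$ is at most the number performed by $A$.
   Context: Egg-drop problem: there is a building with floors $1,\dots,N$ and all eggs have the same unknown strength $s\in\{0,1,\dots,N\}$; every value of $s$ is possible and is an instance of the problem. An experiment at floor $x\in\{1,\dots,N\}$ consists of dropping an egg from floor $x$; the egg survives (success) if $x\le s$ and breaks (failure) if $x>s$. One starts with $k$ eggs, and an experiment can be performed only if at least one egg is in hand. After a failure the number of eggs in hand decreases by one. After a success the number of eggs in hand: is unchanged for Standard Eggs; is restored to the original number $k$ for Replacement Eggs; increases by one for Bonus Eggs. An algorithm chooses each experiment deterministically from the outcomes of the previous experiments (respecting the egg-supply rules). It solves the problem if it is finite and determines $s$ for every instance. It is non-redundant if no experiment is performed whose outcome is guaranteed to be success or guaranteed to be failure (given the outcomes of the experiments already performed). *)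

theory Defs
  imports Main
begin

datatype variant = Standard | Replacement | Bonus

text \<open>Eggs in hand after one experiment, when \<open>e\<close> eggs were in hand before it and the game
  started with \<open>k\<close> eggs.  Outcome \<open>True\<close> is success (the egg survives), \<open>False\<close> is failure.\<close>

fun eggs_step :: "variant \<Rightarrow> nat \<Rightarrow> nat \<Rightarrow> bool \<Rightarrow> nat" where
  "eggs_step v k e False = e - 1"
| "eggs_step Standard k e True = e"
| "eggs_step Replacement k e True = k"
| "eggs_step Bonus k e True = e + 1"

definition eggs_in_hand :: "variant \<Rightarrow> nat \<Rightarrow> bool list \<Rightarrow> nat" where
  "eggs_in_hand v k os = foldl (eggs_step v k) k os"

text \<open>An algorithm maps the outcomes of the previous experiments, in chronological order, to the
  floor of the next experiment, or to \<open>None\<close> when it stops.  Nothing forces it to stop;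
  termination, floor bounds and egg supply are separate requirements below.\<close>

type_synonym algorithm = "bool list \<Rightarrow> nat option"

text \<open>The (floor, outcome) pairs of the first \<open>n\<close> experiments that \<open>A\<close> performs on an instance of
  strength \<open>s\<close>; of all its experiments if it stops earlier.\<close>

fun transcript :: "algorithm \<Rightarrow> nat \<Rightarrow> nat \<Rightarrow> (nat \<times> bool) list" where
  "transcript A s 0 = []"
| "transcript A s (Suc n) =
    (let tr = transcript A s n in
     case A (map snd tr) of None \<Rightarrow> tr | Some x \<Rightarrow> tr @ [(x, x \<le> s)])"

definition next_experiment :: "algorithm \<Rightarrow> nat \<Rightarrow> nat \<Rightarrow> nat option" where
  "next_experiment A s n = A (map snd (transcript A s n))"

definition candidates :: "nat \<Rightarrow> (nat \<times> bool) list \<Rightarrow> nat set" where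
  "candidates N tr = {t \<in> {0..N}. \<forall>(x, b) \<in> set tr. b \<longleftrightarrow> x \<le> t}"

definition respects_rules :: "variant \<Rightarrow> nat \<Rightarrow> nat \<Rightarrow> algorithm \<Rightarrow> bool" where
  "respects_rules v k N A \<longleftrightarrow>
    (\<forall>s \<in> {0..N}. \<forall>n x. next_experiment A s n = Some x \<longrightarrow>
       x \<in> {1..N} \<and> eggs_in_hand v k (map snd (transcript A s n)) \<ge> 1)"

text \<open>As there are only finitely many instances, stopping on each of them is the same as having a
  common bound on the number of experiments.\<close>

definition finite_algorithm :: "nat \<Rightarrow> algorithm \<Rightarrow> bool" where
  "finite_algorithm N A \<longleftrightarrow> (\<forall>s \<in> {0..N}. \<exists>n. next_experiment A s n = None)"

text \<open>Only meaningful if \<open>A\<close> stops on \<open>s\<close>.\<close>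

definition num_experiments :: "algorithm \<Rightarrow> nat \<Rightarrow> nat" where
  "num_experiments A s = (LEAST n. next_experiment A s n = None)"

definition determines_strength :: "nat \<Rightarrow> algorithm \<Rightarrow> bool" where
  "determines_strength N A \<longleftrightarrow>
    (\<forall>s \<in> {0..N}. candidates N (transcript A s (num_experiments A s)) = {s})"

definition solves :: "variant \<Rightarrow> nat \<Rightarrow> nat \<Rightarrow> algorithm \<Rightarrow> bool" where
  "solves v k N A \<longleftrightarrow>
    respects_rules v k N A \<and> finite_algorithm N A \<and> determines_strength N A"

definition non_redundant :: "nat \<Rightarrow> algorithm \<Rightarrow> bool" where
  "non_redundant N A \<longleftrightarrow>
    (\<forall>s \<in> {0..N}. \<forall>n x. next_experiment A s n = Some x \<longrightarrow>
       \<not> (\<forall>t \<in> candidates N (transcript A s n). x \<le> t) \<and>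
       \<not> (\<forall>t \<in> candidates N (transcript A s n). x > t))"

end

theory Submission
  imports Defs
begin

text \<open>
  Dropping every redundant experiment is not a valid proof: under Replacement Eggs and Bonus Eggs a
  drop whose success is guaranteed still pays, because it supplies eggs that later experiments may
  need.  The two kinds of redundancy are therefore treated differently.  Suppose that the strength
  is known to lie in \<open>{lo..hi}\<close> and that the given algorithm now tests floor \<open>x\<close>.

  If \<open>x > hi\<close>, the drop is bound to fail and costs an egg.  It is skipped, and the simulation
  continues as after the failure, with at least as many eggs.  More eggs never hurt, since every
  supply rule is monotone in the number of eggs in hand.

  If \<open>x \<le> lo\<close>, the drop is bound to succeed.  It is replaced by a drop from floor \<open>lo + 1\<close>, which is
  not redundant unless \<open>lo = hi\<close>, when the strength is known anyway.  A success earns the same eggs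
  as the original drop and yields additional information.  A failure reveals that the strength is
  \<open>lo\<close>, so that no further egg is needed.

  Either way, each instance costs at most as many experiments as before.  The transformation is
  carried out on decision trees (\<open>prune\<close>), where it is a structural recursion and each of its
  properties is an induction that speaks of one instance at a time, by way of the list of
  experiments on the corresponding branch.  An algorithm that stops on all of the finitely many
  instances is, on those instances, the same as the finite tree that arises by unfolding it to a
  common bound (\<open>path_unfold\<close>), and any tree can be played as an algorithm (\<open>transcript_play\<close>).
\<close>

section \<open>Decision trees\<close>

datatype decision_tree =
    Stop
  | Test nat (on_failure: decision_tree) (on_success: decision_tree)

fun path :: "decision_tree \<Rightarrow> nat \<Rightarrow> (nat \<times> bool) list" where
  "path Stop s = []"
| "path (Test x f g) s = (x, x \<le> s) # path (if x \<le> s then g else f) s"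

definition consistent :: "nat \<Rightarrow> (nat \<times> bool) list \<Rightarrow> bool" where
  "consistent t tr \<longleftrightarrow> (\<forall>(x, b) \<in> set tr. b \<longleftrightarrow> x \<le> t)"

lemma consistent_simps [simp]:
  "consistent t []"
  "consistent t ((x, b) # tr) \<longleftrightarrow> (b \<longleftrightarrow> x \<le> t) \<and> consistent t tr"
  by (auto simp: consistent_def)

lemma candidates_eq: "candidates N tr = {t \<in> {0..N}. consistent t tr}"
  by (simp add: candidates_def consistent_def)

lemma consistent_path: "consistent s (path t s)"
  by (induction t) auto

fun supplied :: "variant \<Rightarrow> nat \<Rightarrow> nat \<Rightarrow> (nat \<times> bool) list \<Rightarrow> bool" where
  "supplied v k e [] \<longleftrightarrow> True"
| "supplied v k e ((x, b) # tr) \<longleftrightarrow> e \<ge> 1 \<and> supplied v k (eggs_step v k e b) tr"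

lemma supplied_iff:
  "supplied v k e tr \<longleftrightarrow>
    (\<forall>n < length tr. foldl (eggs_step v k) e (map snd (take n tr)) \<ge> 1)"
proof (induction v k e tr rule: supplied.induct)
  case (2 v k e x b tr)
  then show ?case by (auto simp: All_less_Suc2)
qed simp

lemma eggs_step_mono: "e \<le> e' \<Longrightarrow> eggs_step v k e b \<le> eggs_step v k e' b"
  by (cases v; cases b) auto

section \<open>Pruning\<close>

text \<open>The interval \<open>{lo..hi}\<close> holds the strengths that are still possible.  The floor
  \<open>max x (lo + 1)\<close> treats a genuine experiment and a guaranteed success alike: it is \<open>x\<close> for the
  former, and the lowest informative floor for the latter.  In the second case the failure branch
  \<open>f\<close> is one that the original tree can never reach, but its interval is \<open>{lo..lo}\<close>, so that
  pruning discards it.\<close>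

fun prune :: "nat \<Rightarrow> nat \<Rightarrow> decision_tree \<Rightarrow> decision_tree" where
  "prune lo hi Stop = Stop"
| "prune lo hi (Test x f g) =
    (if lo = hi then Stop
     else if hi < x then prune lo hi f
     else (let y = max x (lo + 1) in Test y (prune lo (y - 1) f) (prune y hi g)))"

lemma prune_singleton [simp]: "prune lo lo t = Stop"
  by (cases t) auto

text \<open>The three transfer results below and the non-redundancy of the result all follow the
  recursion of \<open>prune\<close>.  This induction rule, for a fixed instance \<open>s\<close>, splits the recursion into
  the ways in which the branches of the two trees can correspond: both end, the pruned tree ends
  because \<open>s\<close> is known, the original makes a failing drop that is skipped, both fail or both succeed
  (the latter possibly at different floors), or the pruned tree identifies \<open>s\<close> by a failure that
  replaces a success.\<close>

lemma prune_branch_induct [consumes 2, case_names stop known skip fail identify succeed]: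
  assumes "lo \<le> s" "s \<le> hi"
    and "\<And>lo hi. lo \<le> s \<Longrightarrow> s \<le> hi \<Longrightarrow> P lo hi [] []"
    and "\<And>lo hi p. lo = s \<Longrightarrow> hi = s \<Longrightarrow> P lo hi p []"
    and "\<And>lo hi x p q. lo \<le> s \<Longrightarrow> s \<le> hi \<Longrightarrow> hi < x \<Longrightarrow> P lo hi p q \<Longrightarrow>
           P lo hi ((x, False) # p) q"
    and "\<And>lo hi x p q. lo \<le> s \<Longrightarrow> s < x \<Longrightarrow> x \<le> hi \<Longrightarrow> P lo (x - 1) p q \<Longrightarrow>
           P lo hi ((x, False) # p) ((x, False) # q)"
    and "\<And>lo hi x p. lo = s \<Longrightarrow> s < hi \<Longrightarrow> x \<le> s \<Longrightarrow>
           P lo hi ((x, True) # p) [(Suc s, False)]"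
    and "\<And>lo hi x y p q. x \<le> y \<Longrightarrow> lo < y \<Longrightarrow> y \<le> s \<Longrightarrow> s \<le> hi \<Longrightarrow> P y hi p q \<Longrightarrow>
           P lo hi ((x, True) # p) ((y, True) # q)"
  shows "P lo hi (path t s) (path (prune lo hi t) s)"
  using assms(1,2)
proof (induction t arbitrary: lo hi)
  case Stop
  then show ?case using assms(3) by simp
next
  case (Test x f g)
  define y where "y = max x (lo + 1)"
  consider "lo = hi" | "lo < hi" "hi < x" | "lo < hi" "x \<le> hi" "s < x"
    | "lo < hi" "x \<le> s" "s < y" | "lo < hi" "x \<le> hi" "y \<le> s"
    using Test.prems by (cases "lo = hi"; cases "hi < x"; cases "s < x"; cases "s < y") auto
  then show ?case
  proof cases
    case 1
    then show ?thesis using Test.prems assms(4) by simp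
  next
    case 2
    then show ?thesis using Test assms(5) by simp
  next
    case 3
    then have "max x (Suc lo) = x" using Test.prems by simp
    with 3 show ?thesis using Test assms(6) by (simp add: Let_def)
  next
    case 4
    then have "lo = s" "max x (Suc lo) = Suc s" using Test.prems by (auto simp: y_def)
    with 4 show ?thesis using Test.prems assms(7) by (simp add: Let_def)
  next
    case 5
    then have "x \<le> y" "lo < y" "x \<le> s" and y: "max x (Suc lo) = y" by (auto simp: y_def)
    with 5 show ?thesis using Test assms(8)[of x y] by (simp add: Let_def y)
  qed
qed

lemma length_path_prune:
  assumes "lo \<le> s" "s \<le> hi"
  shows "length (path (prune lo hi t) s) \<le> length (path t s)"
  using assms by (induction rule: prune_branch_induct) auto

text \<open>A skipped failure leaves the pruned tree with more eggs than the original one, hence the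
  generalization to \<open>e \<le> e'\<close>.\<close>

lemma supplied_path_prune:
  assumes "lo \<le> s" "s \<le> hi" "supplied v k e (path t s)" "e \<le> e'"
  shows "supplied v k e' (path (prune lo hi t) s)"
proof -
  have "\<forall>e e'. supplied v k e (path t s) \<longrightarrow> e \<le> e' \<longrightarrow>
      supplied v k e' (path (prune lo hi t) s)"
    using assms(1,2)
  proof (induction rule: prune_branch_induct)
    case (skip lo hi x p q)
    show ?case
    proof (intro allI impI)
      fix e e' assume "supplied v k e ((x, False) # p)" "e \<le> e'"
      then have "supplied v k (e - 1) p" "e - 1 \<le> e'" by auto
      then show "supplied v k e' q" using skip.IH by blast
    qed
  next
    case (fail lo hi x p q)
    show ?case
    proof (intro allI impI)
      fix e e' assume "supplied v k e ((x, False) # p)" "e \<le> e'"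
      then show "supplied v k e' ((x, False) # q)"
        using fail.IH eggs_step_mono[of e e' v k False] by auto
    qed
  next
    case (succeed lo hi x y p q)
    show ?case
    proof (intro allI impI)
      fix e e' assume "supplied v k e ((x, True) # p)" "e \<le> e'"
      then show "supplied v k e' ((y, True) # q)"
        using succeed.IH eggs_step_mono[of e e' v k True] by auto
    qed
  qed auto
  then show ?thesis using assms(3,4) by blast
qed

text \<open>A skipped failure excludes no candidate.  A success moved from \<open>x\<close> up to \<open>y\<close> excludes every
  candidate that the original success excludes.\<close>

lemma identifies_path_prune:
  assumes "lo \<le> s" "s \<le> hi" "{u \<in> {lo..hi}. consistent u (path t s)} \<subseteq> {s}"
  shows "{u \<in> {lo..hi}. consistent u (path (prune lo hi t) s)} \<subseteq> {s}"
  using assms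
proof (induction rule: prune_branch_induct)
  case (skip lo hi x p q)
  have "{u \<in> {lo..hi}. consistent u ((x, False) # p)} = {u \<in> {lo..hi}. consistent u p}"
    using skip.hyps by auto
  then show ?case using skip.IH skip.prems by metis
next
  case (fail lo hi x p q)
  have "{u \<in> {lo..hi}. consistent u ((x, False) # r)} = {u \<in> {lo..x - 1}. consistent u r}" for r
    using fail.hyps by auto
  then show ?case using fail.IH fail.prems by metis
next
  case (succeed lo hi x y p q)
  have "{u \<in> {y..hi}. consistent u p} \<subseteq> {u \<in> {lo..hi}. consistent u ((x, True) # p)}"
    using succeed.hyps by auto
  moreover have "{u \<in> {lo..hi}. consistent u ((y, True) # q)} = {u \<in> {y..hi}. consistent u q}"
    using succeed.hyps by auto
  ultimately show ?case using succeed.IH[OF subset_trans[OF _ succeed.prems]] by simp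
next
  case (identify lo hi x p)
  show ?case using identify.hyps by auto
qed simp_all

text \<open>The end points of the current interval are themselves two candidates, one for either outcome
  of the next experiment.  As they lie in the initial interval, the floor does so, too.\<close>

lemma path_prune_non_redundant:
  assumes "lo \<le> s" "s \<le> hi" "n < length (path (prune lo hi t) s)"
  shows "\<exists>a b. lo \<le> a \<and> a < fst (path (prune lo hi t) s ! n) \<and>
           fst (path (prune lo hi t) s ! n) \<le> b \<and> b \<le> hi \<and>
           consistent a (take n (path (prune lo hi t) s)) \<and>
           consistent b (take n (path (prune lo hi t) s))"
proof -
  have "\<forall>n < length (path (prune lo hi t) s).
          \<exists>a b. lo \<le> a \<and> a < fst (path (prune lo hi t) s ! n) \<and>
           fst (path (prune lo hi t) s ! n) \<le> b \<and> b \<le> hi \<and>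
           consistent a (take n (path (prune lo hi t) s)) \<and>
           consistent b (take n (path (prune lo hi t) s))"
    using assms(1,2)
  proof (induction rule: prune_branch_induct)
    case (fail lo hi x p q)
    have "\<exists>a b. lo \<le> a \<and> a < x \<and> x \<le> b \<and> b \<le> hi"
      using fail.hyps by (intro exI[of _ lo] exI[of _ hi]) auto
    moreover have "\<exists>a b. lo \<le> a \<and> a < fst (q ! n) \<and> fst (q ! n) \<le> b \<and> b \<le> hi \<and>
        a < x \<and> consistent a (take n q) \<and> b < x \<and> consistent b (take n q)"
      if n: "n < length q" for n
    proof -
      obtain a b where "lo \<le> a" "a < fst (q ! n)" "fst (q ! n) \<le> b" "b \<le> x - 1"
        "consistent a (take n q)" "consistent b (take n q)"
        using fail.IH n by blast
      then show ?thesis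
        using fail.hyps by (intro exI[of _ a] exI[of _ b]) auto
    qed
    ultimately show ?case
      by (auto simp: All_less_Suc2 not_le)
  next
    case (identify lo hi x p)
    then show ?case
      by (intro allI impI exI[of _ s] exI[of _ hi]) auto
  next
    case (succeed lo hi x y p q)
    have "\<exists>a b. lo \<le> a \<and> a < y \<and> y \<le> b \<and> b \<le> hi"
      using succeed.hyps by (intro exI[of _ lo] exI[of _ hi]) auto
    moreover have "\<exists>a b. lo \<le> a \<and> a < fst (q ! n) \<and> fst (q ! n) \<le> b \<and> b \<le> hi \<and>
        y \<le> a \<and> consistent a (take n q) \<and> y \<le> b \<and> consistent b (take n q)"
      if n: "n < length q" for n
    proof -
      obtain a b where "y \<le> a" "a < fst (q ! n)" "fst (q ! n) \<le> b" "b \<le> hi"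
        "consistent a (take n q)" "consistent b (take n q)"
        using succeed.IH n by blast
      then show ?thesis
        using succeed.hyps by (intro exI[of _ a] exI[of _ b]) auto
    qed
    ultimately show ?case
      by (auto simp: All_less_Suc2)
  qed auto
  then show ?thesis using assms(3) by blast
qed

section \<open>From algorithms to trees and back\<close>

fun unfold :: "algorithm \<Rightarrow> bool list \<Rightarrow> nat \<Rightarrow> decision_tree" where
  "unfold A os 0 = Stop"
| "unfold A os (Suc n) =
    (case A os of None \<Rightarrow> Stop
     | Some x \<Rightarrow> Test x (unfold A (os @ [False]) n) (unfold A (os @ [True]) n))"

lemma transcript_stopped:
  "next_experiment A s m = None \<Longrightarrow> transcript A s (m + n) = transcript A s m"
  by (induction n) (auto simp: next_experiment_def)

text \<open>The transcript grows at its end, the branch of a tree from its start; hence the offset \<open>m\<close>.\<close>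

lemma transcript_add:
  "transcript A s (m + n) =
     transcript A s m @ path (unfold A (map snd (transcript A s m)) n) s"
proof (induction n arbitrary: m)
  case (Suc n)
  show ?case
  proof (cases "A (map snd (transcript A s m))")
    case None
    then show ?thesis
      using transcript_stopped[of A s m "Suc n"] by (simp add: next_experiment_def)
  next
    case (Some x)
    then have "transcript A s (Suc m) = transcript A s m @ [(x, x \<le> s)]" by simp
    then show ?thesis using Suc.IH[of "Suc m"] Some by (simp del: transcript.simps)
  qed
qed simp

lemma length_transcript:
  assumes "\<forall>m < n. next_experiment A s m \<noteq> None"
  shows "length (transcript A s n) = n"
  using assms by (induction n) (auto simp: next_experiment_def)

lemma path_unfold:
  assumes "next_experiment A s m = None" "num_experiments A s \<le> n"
  shows "path (unfold A [] n) s = transcript A s (num_experiments A s)"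
proof -
  have "next_experiment A s (num_experiments A s) = None"
    unfolding num_experiments_def using assms(1) by (rule LeastI)
  then show ?thesis
    using transcript_add[of A s 0 n] assms(2)
      transcript_stopped[of A s "num_experiments A s" "n - num_experiments A s"]
    by simp
qed

lemma next_experiment_before_end:
  "m < num_experiments A s \<Longrightarrow> next_experiment A s m \<noteq> None"
  unfolding num_experiments_def by (rule not_less_Least)

lemma length_transcript_before_end:
  "m \<le> num_experiments A s \<Longrightarrow> length (transcript A s m) = m"
  using next_experiment_before_end by (intro length_transcript allI impI) (meson order.strict_trans2)

lemma take_transcript:
  assumes "m \<le> num_experiments A s"
  shows "take m (transcript A s (num_experiments A s)) = transcript A s m"
  using transcript_add[of A s m "num_experiments A s - m"] length_transcript_before_end[OF assms]
    assms by simp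

lemma supplied_transcript:
  assumes "respects_rules v k N A" "s \<le> N"
  shows "supplied v k k (transcript A s (num_experiments A s))"
  unfolding supplied_iff
proof (intro allI impI)
  fix m assume "m < length (transcript A s (num_experiments A s))"
  then have m: "m < num_experiments A s" by (simp add: length_transcript_before_end)
  then obtain x where "next_experiment A s m = Some x"
    using next_experiment_before_end by blast
  then have "eggs_in_hand v k (map snd (transcript A s m)) \<ge> 1"
    using assms by (auto simp: respects_rules_def)
  then show "foldl (eggs_step v k) k (map snd (take m (transcript A s (num_experiments A s)))) \<ge> 1"
    using m take_transcript[of m A s] by (simp add: eggs_in_hand_def)
qed

fun play :: "decision_tree \<Rightarrow> algorithm" where
  "play Stop os = None"
| "play (Test x f g) [] = Some x"
| "play (Test x f g) (b # os) = play (if b then g else f) os"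

lemma play_take_path:
  "play t (map snd (take n (path t s))) =
     (if n < length (path t s) then Some (fst (path t s ! n)) else None)"
proof (induction t arbitrary: n)
  case (Test x f g)
  then show ?case by (cases n) (simp_all del: take_all)
qed simp

lemma transcript_play: "transcript (play t) s n = take n (path t s)"
proof (induction n)
  case (Suc n)
  have "path t s ! n = (x, x \<le> s)" if "n < length (path t s)" "fst (path t s ! n) = x" for x
    using consistent_path[of s t] that nth_mem[OF that(1)]
    by (auto simp: consistent_def prod_eq_iff)
  then show ?case
    using Suc by (auto simp: play_take_path take_Suc_conv_app_nth)
qed simp

lemma next_experiment_play:
  "next_experiment (play t) s n =
     (if n < length (path t s) then Some (fst (path t s ! n)) else None)"
  by (simp add: next_experiment_def transcript_play play_take_path)

lemma num_experiments_play: "num_experiments (play t) s = length (path t s)"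
  unfolding num_experiments_def
  by (rule Least_equality) (auto simp: next_experiment_play split: if_splits)

section \<open>Removing redundancy from an algorithm\<close>

theorem proposition2p10:
  fixes v :: variant and k N :: nat and A :: algorithm
  assumes "k \<ge> 1"
    and "solves v k N A"
  shows "\<exists>A'. solves v k N A' \<and> non_redundant N A' \<and>
           (\<forall>s \<in> {0..N}. num_experiments A' s \<le> num_experiments A s)"
proof -
  have rules: "respects_rules v k N A" and fin: "finite_algorithm N A"
    and det: "determines_strength N A"
    using assms(2) by (auto simp: solves_def)
  define n where "n = Max (num_experiments A ` {0..N})"
  define t where "t = unfold A [] n"
  define t' where "t' = prune 0 N t"
  have path_t: "path t s = transcript A s (num_experiments A s)" if s: "s \<le> N" for s
  proof -
    obtain m where "next_experiment A s m = None"
      using fin s by (force simp: finite_algorithm_def)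
    moreover have "num_experiments A s \<le> n"
      using s by (auto simp: n_def intro: Max_ge)
    ultimately show ?thesis unfolding t_def by (rule path_unfold)
  qed
  have cheap: "length (path t' s) \<le> num_experiments A s" if "s \<le> N" for s
    using length_path_prune[of 0 s N t] that
    by (simp add: t'_def path_t length_transcript_before_end)
  have informative: "\<exists>a b. a < x \<and> x \<le> b \<and>
      a \<in> candidates N (take m (path t' s)) \<and> b \<in> candidates N (take m (path t' s))"
    if s: "s \<le> N" and x: "next_experiment (play t') s m = Some x" for s m x
  proof -
    have "m < length (path t' s)" "x = fst (path t' s ! m)"
      using x by (auto simp: next_experiment_play split: if_splits)
    then obtain a b where "a < x" "x \<le> b" "b \<le> N"
      "consistent a (take m (path t' s))" "consistent b (take m (path t' s))"
      using path_prune_non_redundant[of 0 s N m t] s unfolding t'_def by auto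
    then show ?thesis
      by (intro exI[of _ a] exI[of _ b]) (auto simp: candidates_eq)
  qed
  have "respects_rules v k N (play t')"
    unfolding respects_rules_def
  proof (intro ballI allI impI)
    fix s m x assume s: "s \<in> {0..N}" and x: "next_experiment (play t') s m = Some x"
    then have "supplied v k k (path t' s)"
      using supplied_path_prune[of 0 s N v k k t k] supplied_transcript[OF rules]
      by (simp add: t'_def path_t)
    moreover have "m < length (path t' s)"
      using x by (auto simp: next_experiment_play split: if_splits)
    ultimately have "eggs_in_hand v k (map snd (take m (path t' s))) \<ge> 1"
      by (simp add: supplied_iff eggs_in_hand_def)
    moreover have "x \<in> {1..N}"
      using informative[OF _ x] s by (auto simp: candidates_eq)
    ultimately show "x \<in> {1..N} \<and> eggs_in_hand v k (map snd (transcript (play t') s m)) \<ge> 1"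
      by (simp add: transcript_play)
  qed
  moreover have "finite_algorithm N (play t')"
    by (auto simp: finite_algorithm_def next_experiment_play)
  moreover have "determines_strength N (play t')"
    unfolding determines_strength_def
  proof (intro ballI)
    fix s assume s: "s \<in> {0..N}"
    then have "candidates N (transcript A s (num_experiments A s)) = {s}"
      using det unfolding determines_strength_def by blast
    moreover have "path t s = transcript A s (num_experiments A s)"
      using s by (intro path_t) simp
    ultimately have "{u \<in> {0..N}. consistent u (path t s)} \<subseteq> {s}"
      by (simp add: candidates_eq)
    then have "{u \<in> {0..N}. consistent u (path t' s)} \<subseteq> {s}"
      using s unfolding t'_def by (intro identifies_path_prune) auto
    then show "candidates N (transcript (play t') s (num_experiments (play t') s)) = {s}"
      using s consistent_path[of s t']
      by (auto simp: candidates_eq transcript_play num_experiments_play)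
  qed
  moreover have "non_redundant N (play t')"
    unfolding non_redundant_def transcript_play
  proof (intro ballI allI impI)
    fix s m x assume s: "s \<in> {0..N}" and x: "next_experiment (play t') s m = Some x"
    then obtain a b where "a < x" "x \<le> b"
      "a \<in> candidates N (take m (path t' s))" "b \<in> candidates N (take m (path t' s))"
      using informative[OF _ x] by auto
    then show "\<not> (\<forall>u \<in> candidates N (take m (path t' s)). x \<le> u) \<and>
        \<not> (\<forall>u \<in> candidates N (take m (path t' s)). x > u)"
      using leD by blast
  qed
  moreover have "\<forall>s \<in> {0..N}. num_experiments (play t') s \<le> num_experiments A s"
    using cheap by (simp add: num_experiments_play)
  ultimately show ?thesis unfolding solves_def by blast
qed

end
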